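(* Let $n$ be a positive integer divisible by $10$, $h=1/n$, and $\mathbf{y}=(y_i)_{i=1}^n$ with $y_i=(i-1)h$. Let $b_1,b_2$ be nonnegative $1$-periodic functions which, on $[0,1)$, are supported in $[0,0.2]$ and which satisfy $b_1|_{\mathbf{y}\cap[0,0.2]}\le_{\mathrm{C}} b_2|_{\mathbf{y}\cap[0,0.2]}$. Put $\mathbf{b}_1=(T^{0.1}b_1)|_{\mathbf{y}}$ and $\mathbf{b}_2=(T^{0.7}b_2)|_{\mathbf{y}}$, and let $\mathbf{C}$ be the $n\times n$ cost matrix with $C_{ij}=|y_i-y_j|^2$ if $|y_i-y_j|\le 0.3$ and $C_{ij}=\infty$ if $|y_i-y_j|>0.3$. For $\lambda=(\lambda_1,\lambda_2)$ with $\lambda_1,\lambda_2>0$ and $\lambda_1+\lambda_2=1$, let $\mathbf{a}_\lambda$ denote an sOT barycenter of $(\mathbf{b}_1,\mathbf{b}_2)$ with weights $\lambda$ and cost $\mathbf{C}$. Then (for any choice of the barycenters $\mathbf{a}_\lambda$) $$\lim_{(\lambda_1,\lambda_2)\to(1,0)}\mathbf{a}_\lambda=(T^{0.4}b_2)|_{\mathbf{y}},\qquad \lim_{(\lambda_1,\lambda_2)\to(0,1)}\mathbf{a}_\lambda=(T^{0.4}b_1)|_{\mathbf{y}}.$$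
   Context: For a $1$-periodic function $f$, $T^t f$ is the shifted function $(T^tf)(x)=f(x-t)$. For a function $f$ and a finite set of mesh points, $f|_{\cdot}$ is the vector of values of $f$ at those points, in increasing order; $\mathbf{y}\cap[0,0.2]$ is the set of mesh points $y_i$ lying in $[0,0.2]$. Cumulative sum inequality: for $\mathbf{u},\mathbf{v}\in\mathbb{R}^N$, $\mathbf{u}\le_{\mathrm{C}}\mathbf{v}$ means $\sum_{j=1}^k u_j\le\sum_{j=1}^k v_j$ for $k=1,\dots,N-1$ and $\sum_{j=1}^N u_j=\sum_{j=1}^N v_j$. Couplings: for $\mathbf{u},\mathbf{v}\in\mathbb{R}^n_+$ (nonnegative entries), $\mathbf{U}(\mathbf{u},\mathbf{v})=\{\mathbf{P}\in\mathbb{R}_+^{n\times n}:\mathbf{P}\mathbb{1}=\mathbf{u},\ \mathbf{P}^T\mathbb{1}=\mathbf{v}\}$, where $\mathbb{1}$ is the all-ones vector. $\langle\mathbf{P},\mathbf{C}\rangle=\sum_{i,j}P_{ij}C_{ij}$ with $0\cdot\infty=0$. sOT barycenter of $(\mathbf{b}_1,\mathbf{b}_2)$ with weights $\lambda$: let $\mathcal{F}$ be the set of pairs $\boldsymbol{\nu}=(\boldsymbol{\nu}_1,\boldsymbol{\nu}_2)$ of nonnegative vectors with $\boldsymbol{\nu}_j\le\mathbf{b}_j$ entrywise and $\|\mathbf{b}_1-\boldsymbol{\nu}_1\|_1=\|\mathbf{b}_2-\boldsymbol{\nu}_2\|_1$, for which there exist $\mathbf{a}\in\mathbb{R}^n_+$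 and $\mathbf{P}_j\in\mathbf{U}(\mathbf{a},\mathbf{b}_j-\boldsymbol{\nu}_j)$ with $\langle\mathbf{P}_j,\mathbf{C}\rangle<\infty$ for $j=1,2$. Let $\mathcal{G}=\operatorname{argmin}_{\boldsymbol{\nu}\in\mathcal{F}}(\|\boldsymbol{\nu}_1\|_1+\|\boldsymbol{\nu}_2\|_1)$. The sOT barycenter problem is to minimize $\lambda_1\langle\mathbf{P}_1,\mathbf{C}\rangle+\lambda_2\langle\mathbf{P}_2,\mathbf{C}\rangle$ over all $\boldsymbol{\nu}\in\mathcal{G}$, $\mathbf{a}\in\mathbb{R}^n_+$ and $\mathbf{P}_j\in\mathbf{U}(\mathbf{a},\mathbf{b}_j-\boldsymbol{\nu}_j)$, $j=1,2$. An sOT barycenter is the component $\mathbf{a}$ of any minimizer. *)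

theory Defs
  imports "HOL-Analysis.Analysis"
begin

(* A vector of length N is a function on nat of which only the entries with index in {1..N} are
   ever used; an n x n matrix is a function of two indices in {1..n}. *)

definition shift :: "real \<Rightarrow> (real \<Rightarrow> real) \<Rightarrow> real \<Rightarrow> real" where
  "shift t f = (\<lambda>x. f (x - t))"

definition values_at :: "(real \<Rightarrow> real) \<Rightarrow> real set \<Rightarrow> nat \<Rightarrow> real" where
  "values_at f S = (\<lambda>i. f (sorted_list_of_set S ! (i - 1)))"

definition mesh_pt :: "nat \<Rightarrow> nat \<Rightarrow> real" where
  "mesh_pt n i = (real i - 1) * (1 / real n)"

definition mesh :: "nat \<Rightarrow> real set" where
  "mesh n = mesh_pt n ` {1..n}"

definition cum_le :: "nat \<Rightarrow> (nat \<Rightarrow> real) \<Rightarrow> (nat \<Rightarrow> real) \<Rightarrow> bool" where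
  "cum_le N u v \<longleftrightarrow>
     (\<forall>k\<in>{1..N - 1}. (\<Sum>j=1..k. u j) \<le> (\<Sum>j=1..k. v j)) \<and>
     (\<Sum>j=1..N. u j) = (\<Sum>j=1..N. v j)"

definition nonneg_vec :: "nat \<Rightarrow> (nat \<Rightarrow> real) \<Rightarrow> bool" where
  "nonneg_vec n u \<longleftrightarrow> (\<forall>i\<in>{1..n}. 0 \<le> u i)"

definition norm1 :: "nat \<Rightarrow> (nat \<Rightarrow> real) \<Rightarrow> real" where
  "norm1 n u = (\<Sum>i=1..n. \<bar>u i\<bar>)"

definition couplings :: "nat \<Rightarrow> (nat \<Rightarrow> real) \<Rightarrow> (nat \<Rightarrow> real) \<Rightarrow> (nat \<Rightarrow> nat \<Rightarrow> real) set" where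
  "couplings n u v = {P.
     (\<forall>i\<in>{1..n}. \<forall>j\<in>{1..n}. 0 \<le> P i j) \<and>
     (\<forall>i\<in>{1..n}. (\<Sum>j=1..n. P i j) = u i) \<and>
     (\<forall>j\<in>{1..n}. (\<Sum>i=1..n. P i j) = v j)}"

(* Multiplication on ereal satisfies 0 * \<infinity> = 0. *)
definition transport_cost :: "nat \<Rightarrow> (nat \<Rightarrow> nat \<Rightarrow> real) \<Rightarrow> (nat \<Rightarrow> nat \<Rightarrow> ereal) \<Rightarrow> ereal" where
  "transport_cost n P C = (\<Sum>i=1..n. \<Sum>j=1..n. ereal (P i j) * C i j)"

(* \<nu>1 and \<nu>2 are the parts of b1 and b2 that are discarded before transport. *)
definition sOT_feasible ::
  "nat \<Rightarrow> (nat \<Rightarrow> nat \<Rightarrow> ereal) \<Rightarrow> (nat \<Rightarrow> real) \<Rightarrow> (nat \<Rightarrow> real) \<Rightarrow> ((nat \<Rightarrow> real) \<times> (nat \<Rightarrow> real)) set" where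
  "sOT_feasible n C b1 b2 = {(\<nu>1, \<nu>2).
     nonneg_vec n \<nu>1 \<and> nonneg_vec n \<nu>2 \<and>
     (\<forall>i\<in>{1..n}. \<nu>1 i \<le> b1 i) \<and> (\<forall>i\<in>{1..n}. \<nu>2 i \<le> b2 i) \<and>
     norm1 n (\<lambda>i. b1 i - \<nu>1 i) = norm1 n (\<lambda>i. b2 i - \<nu>2 i) \<and>
     (\<exists>a P1 P2. nonneg_vec n a \<and>
        P1 \<in> couplings n a (\<lambda>i. b1 i - \<nu>1 i) \<and>
        P2 \<in> couplings n a (\<lambda>i. b2 i - \<nu>2 i) \<and>
        transport_cost n P1 C < \<infinity> \<and> transport_cost n P2 C < \<infinity>)}"

definition sOT_minimal ::
  "nat \<Rightarrow> (nat \<Rightarrow> nat \<Rightarrow> ereal) \<Rightarrow> (nat \<Rightarrow> real) \<Rightarrow> (nat \<Rightarrow> real) \<Rightarrow> ((nat \<Rightarrow> real) \<times> (nat \<Rightarrow> real)) set" where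
  "sOT_minimal n C b1 b2 = {\<nu>.
     is_arg_min (\<lambda>(\<nu>1, \<nu>2). norm1 n \<nu>1 + norm1 n \<nu>2) (\<lambda>\<nu>. \<nu> \<in> sOT_feasible n C b1 b2) \<nu>}"

definition sOT_admissible ::
  "nat \<Rightarrow> (nat \<Rightarrow> nat \<Rightarrow> ereal) \<Rightarrow> (nat \<Rightarrow> real) \<Rightarrow> (nat \<Rightarrow> real) \<Rightarrow>
   (((nat \<Rightarrow> real) \<times> (nat \<Rightarrow> real)) \<times> (nat \<Rightarrow> real) \<times> (nat \<Rightarrow> nat \<Rightarrow> real) \<times> (nat \<Rightarrow> nat \<Rightarrow> real)) set" where
  "sOT_admissible n C b1 b2 = {((\<nu>1, \<nu>2), a, P1, P2).
     (\<nu>1, \<nu>2) \<in> sOT_minimal n C b1 b2 \<and> nonneg_vec n a \<and>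
     P1 \<in> couplings n a (\<lambda>i. b1 i - \<nu>1 i) \<and>
     P2 \<in> couplings n a (\<lambda>i. b2 i - \<nu>2 i)}"

definition is_sOT_barycenter ::
  "nat \<Rightarrow> (nat \<Rightarrow> nat \<Rightarrow> ereal) \<Rightarrow> real \<times> real \<Rightarrow> (nat \<Rightarrow> real) \<Rightarrow> (nat \<Rightarrow> real) \<Rightarrow> (nat \<Rightarrow> real) \<Rightarrow> bool" where
  "is_sOT_barycenter n C l b1 b2 a \<longleftrightarrow>
     (\<exists>\<nu> P1 P2. is_arg_min
        (\<lambda>(\<nu>, a, P1, P2). ereal (fst l) * transport_cost n P1 C + ereal (snd l) * transport_cost n P2 C)
        (\<lambda>x. x \<in> sOT_admissible n C b1 b2)
        (\<nu>, a, P1, P2))"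

definition trunc_cost :: "nat \<Rightarrow> nat \<Rightarrow> nat \<Rightarrow> ereal" where
  "trunc_cost n i j =
     (if \<bar>mesh_pt n i - mesh_pt n j\<bar> \<le> 0.3 then ereal (\<bar>mesh_pt n i - mesh_pt n j\<bar>\<^sup>2) else \<infinity>)"

definition weights :: "(real \<times> real) set" where
  "weights = {(l1, l2). 0 < l1 \<and> 0 < l2 \<and> l1 + l2 = 1}"

lemma values_at_mesh:
  assumes "i \<in> {1..n}"
  shows "values_at f (mesh n) i = f (mesh_pt n i)"
proof -
  have sm: "strict_mono_on {1..n} (mesh_pt n)"
    using assms by (auto simp: strict_mono_on_def mesh_pt_def divide_strict_right_mono)
  have "sorted_list_of_set (mesh n) = map (mesh_pt n) [1..<Suc n]"
  proof (rule sorted_distinct_set_unique)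
    show "sorted (map (mesh_pt n) [1..<Suc n])"
      unfolding sorted_map by (rule sorted_wrt_mono_rel[OF _ sorted_upt])
        (auto simp: mesh_pt_def divide_right_mono)
    show "distinct (map (mesh_pt n) [1..<Suc n])"
      using strict_mono_on_imp_inj_on[OF sm]
      by (simp add: distinct_map atLeastLessThanSuc_atLeastAtMost del: upt_Suc)
  qed (auto simp: mesh_def atLeastLessThanSuc_atLeastAtMost simp del: upt_Suc)
  then show ?thesis
    using assms by (auto simp: values_at_def nth_map[of _ "[Suc 0..<Suc n]"] nth_upt simp del: upt_Suc)
qed

end

theory Submission
  imports Defs
begin

text \<open>With \<open>n = 10 m\<close>, index \<open>i\<close> of the first mass and \<open>j\<close> of the second differ by at most \<open>6 m\<close> along
  the monotone coupling, so nothing has to be discarded, and a barycenter is an intermediate mass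
  \<open>a\<close> with finite-cost couplings \<open>P1\<close>, \<open>P2\<close> to both masses. Gluing \<open>P1\<close> and \<open>P2\<close> along \<open>a\<close> gives a
  coupling of the two masses whose mass may be relayed through any point within \<open>3 m\<close> of both
  ends. Relaying from \<open>i\<close> to \<open>j\<close> through \<open>j - 3 m\<close> instead of \<open>k\<close> lowers the first cost by at least
  \<open>2 m (k + 3 m - j) / n\<^sup>2\<close> per unit of mass, while the second cost stays bounded. Optimality of
  \<open>a\<close> thus bounds its mean displacement from the translate of the second mass by a constant times
  \<open>\<lambda>2 / \<lambda>1\<close>. The other limit is the same with the relay point \<open>i + 3 m\<close>.\<close>

section \<open>Couplings and the monotone coupling\<close>

lemma couplingsD:
  assumes "P \<in> couplings n u v"
  shows "\<And>i j. i \<in> {1..n} \<Longrightarrow> j \<in> {1..n} \<Longrightarrow> 0 \<le> P i j"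
    and "\<And>i. i \<in> {1..n} \<Longrightarrow> (\<Sum>j=1..n. P i j) = u i"
    and "\<And>j. j \<in> {1..n} \<Longrightarrow> (\<Sum>i=1..n. P i j) = v j"
  using assms by (auto simp: couplings_def)

lemma couplings_le:
  assumes P: "P \<in> couplings n u v" and i: "i \<in> {1..n}" and j: "j \<in> {1..n}"
  shows "P i j \<le> u i" "P i j \<le> v j"
proof -
  show "P i j \<le> u i"
    using member_le_sum[of j "{1..n}" "P i"] couplingsD[OF P] i j by fastforce
  show "P i j \<le> v j"
    using member_le_sum[of i "{1..n}" "\<lambda>i. P i j"] couplingsD[OF P] i j by fastforce
qed

lemma couplings_total:
  assumes "P \<in> couplings n u v"
  shows "(\<Sum>i=1..n. \<Sum>j=1..n. P i j) = (\<Sum>i=1..n. u i)"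
  using couplingsD(2)[OF assms] by (intro sum.cong) auto

lemma couplings_transpose:
  "P \<in> couplings n u v \<Longrightarrow> (\<lambda>i j. P j i) \<in> couplings n v u"
  by (auto simp: couplings_def)

lemma couplings_cong:
  assumes "\<And>i. i \<in> {1..n} \<Longrightarrow> v i = v' i"
  shows "couplings n u v = couplings n u v'"
  using assms by (auto simp: couplings_def)

text \<open>The north-west corner coupling, written as the mixed second difference of
  \<open>min (U i) (V j)\<close>, where \<open>U\<close> and \<open>V\<close> are the partial sums; both marginals telescope.\<close>

lemma monotone_coupling:
  fixes u v :: "nat \<Rightarrow> real"
  assumes u: "nonneg_vec n u" and v: "nonneg_vec n v"
    and tot: "(\<Sum>i=1..n. u i) = (\<Sum>i=1..n. v i)"
  obtains R where "R \<in> couplings n u v"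
    and "\<And>i j. i \<in> {1..n} \<Longrightarrow> j \<in> {1..n} \<Longrightarrow>
           (\<Sum>k=1..i. u k) \<le> (\<Sum>k=1..j - 1. v k) \<Longrightarrow> R i j = 0"
proof
  define U where "U i = (\<Sum>k=1..i. u k)" for i
  define V where "V i = (\<Sum>k=1..i. v k)" for i
  define R where "R i j = min (U i) (V j) - min (U (i - 1)) (V j)
      - (min (U i) (V (j - 1)) - min (U (i - 1)) (V (j - 1)))" for i j
  have step: "U i = U (i - 1) + u i" "V i = V (i - 1) + v i" if "i \<in> {1..n}" for i
    using that by (cases i; simp add: U_def V_def)+
  have nn: "0 \<le> u i" "0 \<le> v i" if "i \<in> {1..n}" for i
    using that u v by (auto simp: nonneg_vec_def)
  have U0: "U 0 = 0" "V 0 = 0" by (auto simp: U_def V_def)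
  have bd: "0 \<le> U i" "0 \<le> V i" "U i \<le> U n" "V i \<le> V n" if "i \<le> n" for i
    unfolding U_def V_def using that nn by (auto intro!: sum_nonneg sum_mono2)
  have UV: "U n = V n" using tot by (simp add: U_def V_def)
  have tel: "(\<Sum>j=1..n. f j - f (j - 1)) = f n - f 0" for f :: "nat \<Rightarrow> real"
    by (induction n) auto
  show "R \<in> couplings n u v"
    unfolding couplings_def
  proof (intro CollectI conjI ballI)
    fix i j assume "i \<in> {1..n}" "j \<in> {1..n}"
    then show "0 \<le> R i j"
      using nn[of i] nn[of j] step[of i] step[of j] by (auto simp: R_def min_def)
  next
    fix i assume i: "i \<in> {1..n}"
    have "i - 1 \<le> n" "i \<le> n" using i by auto
    then have "min (U i) (V n) - min (U (i - 1)) (V n) - (min (U i) (V 0) - min (U (i - 1)) (V 0)) = u i"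
      using U0 step(1)[OF i] bd[of i] bd[of "i - 1"] UV by linarith
    then show "(\<Sum>j=1..n. R i j) = u i"
      unfolding R_def using tel[of "\<lambda>j. min (U i) (V j) - min (U (i - 1)) (V j)"] by simp
  next
    fix j assume j: "j \<in> {1..n}"
    have "j - 1 \<le> n" "j \<le> n" using j by auto
    then have "min (U n) (V j) - min (U n) (V (j - 1)) - (min (U 0) (V j) - min (U 0) (V (j - 1))) = v j"
      using U0 step(2)[OF j] bd[of j] bd[of "j - 1"] UV by linarith
    \<comment> \<open>The same second difference with its two middle terms exchanged, so that it
      telescopes in \<open>i\<close> as well.\<close>
    moreover have "R i j = (min (U i) (V j) - min (U i) (V (j - 1)))
        - (min (U (i - 1)) (V j) - min (U (i - 1)) (V (j - 1)))" for i
      by (simp add: R_def)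
    ultimately show "(\<Sum>i=1..n. R i j) = v j"
      using tel[of "\<lambda>i. min (U i) (V j) - min (U i) (V (j - 1))"] by simp
  qed
  fix i j assume ij: "i \<in> {1..n}" "j \<in> {1..n}" and le: "(\<Sum>k=1..i. u k) \<le> (\<Sum>k=1..j - 1. v k)"
  \<comment> \<open>As \<open>U (i - 1) \<le> U i \<le> V (j - 1) \<le> V j\<close>, all four minima
    are values of \<open>U\<close> and cancel in pairs.\<close>
  then show "R i j = 0"
    using nn[of i] nn[of j] step[of i] step[of j] by (auto simp: R_def min_def U_def V_def)
qed

section \<open>Gluing two couplings along a common marginal\<close>

text \<open>Couplings \<open>P1\<close> of \<open>a\<close>, \<open>u\<close> and \<open>P2\<close> of \<open>a\<close>, \<open>v\<close> are glued along \<open>a\<close>. Where \<open>a k = 0\<close>,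
  both numerators vanish and the junk value \<open>x / 0 = 0\<close> is the right one.\<close>

definition glue :: "nat \<Rightarrow> (nat \<Rightarrow> real) \<Rightarrow> (nat \<Rightarrow> nat \<Rightarrow> real) \<Rightarrow> (nat \<Rightarrow> nat \<Rightarrow> real) \<Rightarrow> nat \<Rightarrow> nat \<Rightarrow> real" where
  "glue n a P1 P2 i j = (\<Sum>k=1..n. P1 k i * P2 k j / a k)"

lemma glue_transpose: "glue n a P2 P1 j i = glue n a P1 P2 i j"
  by (simp add: glue_def mult.commute)

context
  fixes n :: nat and a u v :: "nat \<Rightarrow> real" and P1 P2 :: "nat \<Rightarrow> nat \<Rightarrow> real"
  assumes P1: "P1 \<in> couplings n a u" and P2: "P2 \<in> couplings n a v"
begin

lemma glue_term_sum:
  assumes "k \<in> {1..n}" "i \<in> {1..n}"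
  shows "(\<Sum>j=1..n. P1 k i * P2 k j / a k) = P1 k i"
proof -
  have "(\<Sum>j=1..n. P1 k i * P2 k j / a k) = P1 k i * (\<Sum>j=1..n. P2 k j) / a k"
    by (simp add: sum_distrib_left sum_divide_distrib)
  then show ?thesis
    using assms couplingsD(2)[OF P2] couplings_le(1)[OF P1, of k i] couplingsD(1)[OF P1, of k i]
    by (cases "a k = 0") auto
qed

lemma glue_row_sum:
  assumes "i \<in> {1..n}"
  shows "(\<Sum>j=1..n. glue n a P1 P2 i j) = u i"
proof -
  have "(\<Sum>j=1..n. glue n a P1 P2 i j) = (\<Sum>k=1..n. \<Sum>j=1..n. P1 k i * P2 k j / a k)"
    unfolding glue_def by (rule sum.swap)
  also have "\<dots> = (\<Sum>k=1..n. P1 k i)"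
    using assms by (intro sum.cong glue_term_sum) auto
  finally show ?thesis using assms couplingsD(3)[OF P1] by simp
qed

lemma glue_term_nonneg:
  assumes "k \<in> {1..n}" "i \<in> {1..n}" "j \<in> {1..n}"
  shows "0 \<le> P1 k i * P2 k j / a k"
proof -
  \<comment> \<open>The sign of the denominator comes from
    \<open>0 \<le> P1 k i \<le> a k\<close>.\<close>
  have "0 \<le> P1 k i" "0 \<le> P2 k j" "P1 k i \<le> a k"
    using assms couplingsD(1)[OF P1] couplingsD(1)[OF P2] couplings_le(1)[OF P1] by auto
  then show ?thesis by simp
qed

end

lemma glue_couplings:
  assumes P1: "P1 \<in> couplings n a u" and P2: "P2 \<in> couplings n a v"
  shows "glue n a P1 P2 \<in> couplings n u v"
proof -
  have "0 \<le> glue n a P1 P2 i j" if "i \<in> {1..n}" "j \<in> {1..n}" for i j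
    unfolding glue_def using glue_term_nonneg[OF P1 P2] that by (intro sum_nonneg)
  then show ?thesis
    unfolding couplings_def
    using glue_row_sum[OF P1 P2] glue_row_sum[OF P2 P1] by (simp add: glue_transpose[of n a P2 P1])
qed

lemma glue_support:
  assumes "glue n a P1 P2 i j \<noteq> 0"
  obtains k where "k \<in> {1..n}" "P1 k i \<noteq> 0" "P2 k j \<noteq> 0"
proof -
  from assms obtain k where "k \<in> {1..n}" "P1 k i * P2 k j / a k \<noteq> 0"
    unfolding glue_def by (rule sum.not_neutral_contains_not_neutral)
  then show ?thesis using that by auto
qed

text \<open>All three sums are integrals against one nonnegative weight on triples,
  \<open>q k i j = P1 k i * P2 k j / a k\<close>. Its pair marginals are the glued plan,
  \<open>P1\<close> and \<open>P2\<close>, so an inequality between the integrands on the support of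
  \<open>q\<close> can be integrated. In the applications \<open>d\<close> is the cost of the
  present leg, \<open>c\<close> that of the leg after moving the relay point, and \<open>e\<close>
  the guaranteed saving.\<close>

lemma glue_cost_le:
  fixes c d e :: "nat \<Rightarrow> nat \<Rightarrow> real"
  assumes P1: "P1 \<in> couplings n a u" and P2: "P2 \<in> couplings n a v"
    and le: "\<And>k i j. k \<in> {1..n} \<Longrightarrow> i \<in> {1..n} \<Longrightarrow> j \<in> {1..n} \<Longrightarrow>
               P1 k i \<noteq> 0 \<Longrightarrow> P2 k j \<noteq> 0 \<Longrightarrow> c i j + e k j \<le> d k i"
  shows "(\<Sum>i=1..n. \<Sum>j=1..n. glue n a P1 P2 i j * c i j) + (\<Sum>k=1..n. \<Sum>j=1..n. P2 k j * e k j)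
           \<le> (\<Sum>k=1..n. \<Sum>i=1..n. P1 k i * d k i)"
proof -
  define q where "q k i j = P1 k i * P2 k j / a k" for k i j
  have q1: "(\<Sum>j=1..n. q k i j) = P1 k i" if "k \<in> {1..n}" "i \<in> {1..n}" for k i
    using glue_term_sum[OF P1 P2] that by (simp add: q_def)
  have q2: "(\<Sum>i=1..n. q k i j) = P2 k j" if "k \<in> {1..n}" "j \<in> {1..n}" for k j
    using glue_term_sum[OF P2 P1] that by (simp add: q_def mult.commute)
  have A: "(\<Sum>i=1..n. \<Sum>j=1..n. glue n a P1 P2 i j * c i j)
      = (\<Sum>k=1..n. \<Sum>i=1..n. \<Sum>j=1..n. q k i j * c i j)"
  proof -
    have "(\<Sum>i=1..n. \<Sum>j=1..n. glue n a P1 P2 i j * c i j)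
        = (\<Sum>i=1..n. \<Sum>j=1..n. \<Sum>k=1..n. q k i j * c i j)"
      by (simp add: glue_def q_def sum_distrib_right)
    also have "\<dots> = (\<Sum>i=1..n. \<Sum>k=1..n. \<Sum>j=1..n. q k i j * c i j)"
      by (intro sum.cong refl sum.swap)
    also have "\<dots> = (\<Sum>k=1..n. \<Sum>i=1..n. \<Sum>j=1..n. q k i j * c i j)" by (rule sum.swap)
    finally show ?thesis .
  qed
  have B: "(\<Sum>k=1..n. \<Sum>j=1..n. P2 k j * e k j) = (\<Sum>k=1..n. \<Sum>i=1..n. \<Sum>j=1..n. q k i j * e k j)"
  proof (rule sum.cong[OF refl])
    fix k assume k: "k \<in> {1..n}"
    have "(\<Sum>j=1..n. P2 k j * e k j) = (\<Sum>j=1..n. \<Sum>i=1..n. q k i j * e k j)"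
      using q2 k by (simp flip: sum_distrib_right)
    also have "\<dots> = (\<Sum>i=1..n. \<Sum>j=1..n. q k i j * e k j)" by (rule sum.swap)
    finally show "(\<Sum>j=1..n. P2 k j * e k j) = (\<Sum>i=1..n. \<Sum>j=1..n. q k i j * e k j)" .
  qed
  have C: "(\<Sum>k=1..n. \<Sum>i=1..n. P1 k i * d k i) = (\<Sum>k=1..n. \<Sum>i=1..n. \<Sum>j=1..n. q k i j * d k i)"
    using q1 by (simp flip: sum_distrib_right)
  show ?thesis
    unfolding A B C sum.distrib[symmetric] distrib_left[symmetric]
  proof (intro sum_mono)
    fix k i j assume kij: "k \<in> {1..n}" "i \<in> {1..n}" "j \<in> {1..n}"
    show "q k i j * (c i j + e k j) \<le> q k i j * d k i"
    proof (cases "P1 k i \<noteq> 0 \<and> P2 k j \<noteq> 0")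
      case True
      then show ?thesis
        using le[OF kij] glue_term_nonneg[OF P1 P2 kij] by (intro mult_left_mono) (auto simp: q_def)
    qed (auto simp: q_def)
  qed
qed

text \<open>With \<open>j = k + s\<close>, the numbers \<open>a k\<close> and \<open>v j\<close>
  share the entry \<open>P k j\<close>. What remains of row \<open>k\<close> and of column
  \<open>j\<close> misses the translate by at least one integer step, so each remainder lies between
  0 and the total displacement. If \<open>k + s\<close> is out of range, this applies to the whole
  row \<open>k\<close>. The integer \<open>s\<close> lets both limits use the same bound.\<close>

lemma coupling_displacement:
  fixes s :: int
  assumes P: "P \<in> couplings n a v" and k: "k \<in> {1..n}"
  shows "\<bar>a k - (if int k + s \<in> {1..int n} then v (nat (int k + s)) else 0)\<bar>
           \<le> (\<Sum>k=1..n. \<Sum>j=1..n. P k j * \<bar>int k + s - int j\<bar>)"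
    (is "\<bar>_ - ?w\<bar> \<le> ?E")
proof -
  have nn: "0 \<le> P i j * \<bar>int i + s - int j\<bar>" if "i \<in> {1..n}" "j \<in> {1..n}" for i j
    using couplingsD(1)[OF P that] by simp
  have off: "P i j \<le> P i j * \<bar>int i + s - int j\<bar>" if "i \<in> {1..n}" "j \<in> {1..n}" "int i + s \<noteq> int j" for i j
  proof -
    have "1 \<le> \<bar>int i + s - int j\<bar>" using that by linarith
    then have "1 \<le> real_of_int \<bar>int i + s - int j\<bar>" by linarith
    from mult_left_mono[OF this couplingsD(1)[OF P that(1,2)]] show ?thesis by simp
  qed
  have row: "(\<Sum>j\<in>{1..n}. P k j * \<bar>int k + s - int j\<bar>) \<le> ?E"
    by (rule member_le_sum[of k "{1..n}" "\<lambda>k. \<Sum>j=1..n. P k j * \<bar>int k + s - int j\<bar>"])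
      (use nn k in \<open>auto intro: sum_nonneg\<close>)
  have col: "(\<Sum>i\<in>{1..n}. P i j * \<bar>int i + s - int j\<bar>) \<le> ?E" if "j \<in> {1..n}" for j
  proof -
    have "(\<Sum>i\<in>{1..n}. P i j * \<bar>int i + s - int j\<bar>) \<le> (\<Sum>j=1..n. \<Sum>i=1..n. P i j * \<bar>int i + s - int j\<bar>)"
      by (rule member_le_sum[of j "{1..n}" "\<lambda>j. \<Sum>i=1..n. P i j * \<bar>int i + s - int j\<bar>"])
        (use nn that in \<open>auto intro: sum_nonneg\<close>)
    also have "\<dots> = ?E" by (rule sum.swap)
    finally show ?thesis .
  qed
  show ?thesis
  proof (cases "int k + s \<in> {1..int n}")
    case True
    define j where "j = nat (int k + s)"
    have j: "j \<in> {1..n}" "int j = int k + s" using True by (auto simp: j_def)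
    have "a k = P k j + (\<Sum>j\<in>{1..n} - {j}. P k j)"
      using couplingsD(2)[OF P k] j(1) by (simp add: sum.remove)
    moreover have "(\<Sum>j\<in>{1..n} - {j}. P k j) \<le> (\<Sum>j\<in>{1..n}. P k j * \<bar>int k + s - int j\<bar>)"
      by (rule order_trans[OF sum_mono[OF off] sum_mono2]) (use nn k j in auto)
    moreover have "0 \<le> (\<Sum>j\<in>{1..n} - {j}. P k j)"
      using couplingsD(1)[OF P k] by (intro sum_nonneg) auto
    moreover have "v j = P k j + (\<Sum>i\<in>{1..n} - {k}. P i j)"
      using couplingsD(3)[OF P j(1)] k by (simp add: sum.remove)
    moreover have "(\<Sum>i\<in>{1..n} - {k}. P i j) \<le> (\<Sum>i\<in>{1..n}. P i j * \<bar>int i + s - int j\<bar>)"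
      by (rule order_trans[OF sum_mono[OF off] sum_mono2]) (use nn k j in auto)
    moreover have "0 \<le> (\<Sum>i\<in>{1..n} - {k}. P i j)"
      using couplingsD(1)[OF P _ j(1)] by (intro sum_nonneg) auto
    moreover have "?w = v j" using True by (simp add: j_def)
    ultimately show ?thesis using row col[OF j(1)] by linarith
  next
    case False
    have "0 \<le> a k"
      using couplingsD(1,2)[OF P] k by (metis sum_nonneg)
    moreover have "a k \<le> (\<Sum>j\<in>{1..n}. P k j * \<bar>int k + s - int j\<bar>)"
      unfolding couplingsD(2)[OF P k, symmetric]
      by (rule sum_mono, rule off) (use False k in auto)
    moreover have "?w = 0" using False by auto
    ultimately show ?thesis using row by linarith
  qed
qed

section \<open>The truncated cost, and plans relayed through intermediate points\<close>

lemma transport_cost_trunc: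
  assumes "\<And>i j. i \<in> {1..n} \<Longrightarrow> j \<in> {1..n} \<Longrightarrow> P i j \<noteq> 0 \<Longrightarrow> \<bar>mesh_pt n i - mesh_pt n j\<bar> \<le> 0.3"
  shows "transport_cost n P (trunc_cost n)
           = ereal (\<Sum>i=1..n. \<Sum>j=1..n. P i j * (mesh_pt n i - mesh_pt n j)\<^sup>2)"
proof -
  \<comment> \<open>Pairs beyond the threshold carry no mass, and \<open>0 * \<infinity> = 0\<close>
    removes their cost.\<close>
  have *: "ereal (P i j) * trunc_cost n i j = ereal (P i j * (mesh_pt n i - mesh_pt n j)\<^sup>2)"
    if "i \<in> {1..n}" "j \<in> {1..n}" for i j
    using assms[OF that] by (cases "P i j = 0") (auto simp: trunc_cost_def simp flip: zero_ereal_def)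
  have "transport_cost n P (trunc_cost n)
      = (\<Sum>i=1..n. \<Sum>j=1..n. ereal (P i j * (mesh_pt n i - mesh_pt n j)\<^sup>2))"
    unfolding transport_cost_def by (intro sum.cong refl *) auto
  then show ?thesis by simp
qed

lemma transport_cost_finite_support:
  assumes nn: "\<And>i j. i \<in> {1..n} \<Longrightarrow> j \<in> {1..n} \<Longrightarrow> 0 \<le> P i j"
    and fin: "transport_cost n P (trunc_cost n) < \<infinity>"
    and ij: "i \<in> {1..n}" "j \<in> {1..n}" "P i j \<noteq> 0"
  shows "\<bar>mesh_pt n i - mesh_pt n j\<bar> \<le> 0.3"
proof (rule ccontr)
  assume "\<not> ?thesis"
  then have "trunc_cost n i j = \<infinity>" by (simp add: trunc_cost_def)
  then have "ereal (P i j) * trunc_cost n i j = \<infinity>" using nn[OF ij(1,2)] ij(3) by simp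
  then have "(\<Sum>j=1..n. ereal (P i j) * trunc_cost n i j) = \<infinity>" using ij by (auto simp: sum_Pinfty)
  then have "transport_cost n P (trunc_cost n) = \<infinity>"
    unfolding transport_cost_def using ij by (auto simp: sum_Pinfty)
  then show False using fin by simp
qed

lemma transport_cost_nonneg:
  assumes "\<And>i j. i \<in> {1..n} \<Longrightarrow> j \<in> {1..n} \<Longrightarrow> 0 \<le> P i j"
  shows "0 \<le> transport_cost n P (trunc_cost n)"
  unfolding transport_cost_def using assms
  by (intro sum_nonneg) (auto simp: trunc_cost_def intro!: ereal_0_le_mult)

text \<open>The part of the mass \<open>R\<close> leaving \<open>i\<close> that passes through \<open>x\<close> when \<open>R i j\<close> is relayed
  through \<open>\<phi> i j\<close>.\<close>

definition via :: "nat \<Rightarrow> (nat \<Rightarrow> nat \<Rightarrow> nat) \<Rightarrow> (nat \<Rightarrow> nat \<Rightarrow> real) \<Rightarrow> nat \<Rightarrow> nat \<Rightarrow> real" where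
  "via n \<phi> R x i = (\<Sum>j=1..n. if \<phi> i j = x then R i j else 0)"

lemma via_support:
  assumes "via n \<phi> R x i \<noteq> 0"
  obtains j where "j \<in> {1..n}" "R i j \<noteq> 0" "\<phi> i j = x"
proof -
  from assms obtain j where "j \<in> {1..n}" "(if \<phi> i j = x then R i j else 0) \<noteq> 0"
    unfolding via_def by (rule sum.not_neutral_contains_not_neutral)
  then show ?thesis using that by (auto split: if_splits)
qed

text \<open>A change of variables: \<open>via n \<phi> R\<close> is the image of \<open>R\<close>
  under the map from \<open>(i, j)\<close> to \<open>(\<phi> i j, i)\<close>. The range of
  \<open>\<phi>\<close> is controlled only where \<open>R\<close> has mass, since relay points such
  as \<open>j - 3 * m\<close> or \<open>i + 3 * m\<close> may leave \<open>{1..n}\<close>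
  elsewhere.\<close>

lemma via_cost:
  fixes c :: "nat \<Rightarrow> nat \<Rightarrow> real"
  assumes "\<And>i j. i \<in> {1..n} \<Longrightarrow> j \<in> {1..n} \<Longrightarrow> R i j \<noteq> 0 \<Longrightarrow> \<phi> i j \<in> {1..n}"
  shows "(\<Sum>x=1..n. \<Sum>i=1..n. via n \<phi> R x i * c x i) = (\<Sum>i=1..n. \<Sum>j=1..n. R i j * c (\<phi> i j) i)"
proof -
  have "(\<Sum>x=1..n. \<Sum>i=1..n. via n \<phi> R x i * c x i)
      = (\<Sum>i=1..n. \<Sum>x=1..n. \<Sum>j=1..n. if \<phi> i j = x then R i j * c x i else 0)"
    by (subst sum.swap) (auto simp: via_def sum_distrib_right intro!: sum.cong)
  also have "\<dots> = (\<Sum>i=1..n. \<Sum>j=1..n. \<Sum>x=1..n. if \<phi> i j = x then R i j * c x i else 0)"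
    by (intro sum.cong refl sum.swap)
  also have "\<dots> = (\<Sum>i=1..n. \<Sum>j=1..n. R i j * c (\<phi> i j) i)"
  proof (intro sum.cong refl)
    fix i j assume "i \<in> {1..n}" "j \<in> {1..n}"
    then show "(\<Sum>x=1..n. if \<phi> i j = x then R i j * c x i else 0) = R i j * c (\<phi> i j) i"
      using assms[of i j] by (cases "R i j = 0") (simp_all add: sum.delta')
  qed
  finally show ?thesis .
qed

lemma via_couplings:
  assumes R: "R \<in> couplings n u v"
    and \<phi>: "\<And>i j. i \<in> {1..n} \<Longrightarrow> j \<in> {1..n} \<Longrightarrow> R i j \<noteq> 0 \<Longrightarrow> \<phi> i j \<in> {1..n}"
  shows "via n \<phi> R \<in> couplings n (\<lambda>x. \<Sum>i=1..n. via n \<phi> R x i) u"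
  unfolding couplings_def
proof (intro CollectI conjI ballI refl)
  fix x i assume "x \<in> {1..n}" "i \<in> {1..n}"
  then show "0 \<le> via n \<phi> R x i"
    unfolding via_def using couplingsD(1)[OF R] by (intro sum_nonneg) auto
next
  fix i assume i: "i \<in> {1..n}"
  have "(\<Sum>x=1..n. via n \<phi> R x i) = (\<Sum>j=1..n. \<Sum>x=1..n. if \<phi> i j = x then R i j else 0)"
    unfolding via_def by (rule sum.swap)
  also have "\<dots> = (\<Sum>j=1..n. R i j)"
  proof (intro sum.cong refl)
    fix j assume "j \<in> {1..n}"
    then show "(\<Sum>x=1..n. if \<phi> i j = x then R i j else 0) = R i j"
      using \<phi>[OF i, of j] by (cases "R i j = 0") (simp_all add: sum.delta')
  qed
  finally show "(\<Sum>x=1..n. via n \<phi> R x i) = u i" using couplingsD(2)[OF R i] by simp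
qed

text \<open>Both legs of a relayed plan have the same intermediate mass, as a candidate barycenter
  requires.\<close>

lemma via_swap_row:
  "(\<Sum>j=1..n. via n (\<lambda>j i. \<phi> i j) (\<lambda>j i. R i j) x j) = (\<Sum>i=1..n. via n \<phi> R x i)"
  unfolding via_def by (rule sum.swap)

text \<open>The quadratic cost without truncation. It is real-valued and agrees with
  \<open>transport_cost\<close> on plans that stay within the threshold, so estimates can be made
  over the reals.\<close>

definition sq_cost :: "nat \<Rightarrow> (nat \<Rightarrow> nat \<Rightarrow> real) \<Rightarrow> real" where
  "sq_cost n P = (\<Sum>i=1..n. \<Sum>j=1..n. P i j * (mesh_pt n i - mesh_pt n j)\<^sup>2)"

lemma sq_cost_nonneg:
  assumes "P \<in> couplings n u v"
  shows "0 \<le> sq_cost n P"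
  unfolding sq_cost_def using couplingsD(1)[OF assms] by (intro sum_nonneg) auto

section \<open>Separated masses: relaying, and why nothing is discarded\<close>

text \<open>The problem on the scale of indices: shifts by 0.1 and 0.7 are \<open>m\<close> and
  \<open>7 * m\<close> mesh steps, and an interval of length 0.2 holds \<open>2 * m + 1\<close>
  points. The assumption \<open>cum\<close> is the cumulative sum inequality, with
  \<open>6 * m\<close> the offset between the two blocks.\<close>

locale separated_masses =
  fixes m n :: nat and u v :: "nat \<Rightarrow> real"
  assumes m_pos: "0 < m" and n_eq: "n = 10 * m"
    and u_nonneg: "nonneg_vec n u" and v_nonneg: "nonneg_vec n v"
    and u_supp: "\<And>i. i \<in> {1..n} \<Longrightarrow> u i \<noteq> 0 \<Longrightarrow> m < i \<and> i \<le> 3 * m + 1"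
    and v_supp: "\<And>j. j \<in> {1..n} \<Longrightarrow> v j \<noteq> 0 \<Longrightarrow> 7 * m < j \<and> j \<le> 9 * m + 1"
    and total: "(\<Sum>i=1..n. u i) = (\<Sum>i=1..n. v i)"
    and cum: "\<And>i. m < i \<Longrightarrow> i \<le> 3 * m + 1 \<Longrightarrow> (\<Sum>k=1..i. u k) \<le> (\<Sum>k=1..i + 6 * m. v k)"
begin

lemma mesh_diff: "mesh_pt n i - mesh_pt n j = (real i - real j) / real n"
  by (simp add: mesh_pt_def diff_divide_distrib)

text \<open>As \<open>n = 10 * m\<close>, the threshold 0.3 is exactly \<open>3 * m\<close> steps of
  the mesh.\<close>

lemma near_iff: "\<bar>mesh_pt n i - mesh_pt n j\<bar> \<le> 0.3 \<longleftrightarrow> \<bar>int i - int j\<bar> \<le> 3 * int m"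
proof -
  have "\<bar>mesh_pt n i - mesh_pt n j\<bar> \<le> 0.3 \<longleftrightarrow> \<bar>real i - real j\<bar> \<le> 3 * real m"
    using m_pos unfolding mesh_diff abs_divide by (simp add: n_eq field_simps)
  also have "\<dots> \<longleftrightarrow> \<bar>int i - int j\<bar> \<le> 3 * int m" by linarith
  finally show ?thesis .
qed

definition near :: "(nat \<Rightarrow> nat \<Rightarrow> real) \<Rightarrow> bool" where
  "near P \<longleftrightarrow> (\<forall>i\<in>{1..n}. \<forall>j\<in>{1..n}. P i j \<noteq> 0 \<longrightarrow> \<bar>int i - int j\<bar> \<le> 3 * int m)"

lemma transport_cost_near: "near P \<Longrightarrow> transport_cost n P (trunc_cost n) = ereal (sq_cost n P)"
  unfolding sq_cost_def by (rule transport_cost_trunc) (unfold near_def near_iff, blast)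

lemma near_if_finite:
  assumes "P \<in> couplings n a b" "transport_cost n P (trunc_cost n) < \<infinity>"
  shows "near P"
  unfolding near_def near_iff[symmetric]
  using transport_cost_finite_support[OF couplingsD(1)[OF assms(1)] assms(2)] by blast

lemma coupling_supp:
  assumes "R \<in> couplings n u v" "i \<in> {1..n}" "j \<in> {1..n}" "R i j \<noteq> 0"
  shows "m < i" "i \<le> 3 * m + 1" "7 * m < j" "j \<le> 9 * m + 1"
  using u_supp[of i] v_supp[of j] couplings_le[OF assms(1-3)] couplingsD(1)[OF assms(1-3)] assms by force+

text \<open>Two legs of at most \<open>3 * m\<close> steps cover at most \<open>6 * m\<close> steps,
  so longer transports cannot be relayed.\<close>

definition short_plan :: "(nat \<Rightarrow> nat \<Rightarrow> real) \<Rightarrow> bool" where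
  "short_plan R \<longleftrightarrow> R \<in> couplings n u v \<and> (\<forall>i\<in>{1..n}. \<forall>j\<in>{1..n}. R i j \<noteq> 0 \<longrightarrow> j \<le> i + 6 * m)"

definition relay :: "(nat \<Rightarrow> nat \<Rightarrow> real) \<Rightarrow> (nat \<Rightarrow> nat \<Rightarrow> nat) \<Rightarrow> bool" where
  "relay R \<phi> \<longleftrightarrow> (\<forall>i\<in>{1..n}. \<forall>j\<in>{1..n}. R i j \<noteq> 0 \<longrightarrow> \<phi> i j \<in> {1..n} \<and>
     \<bar>int (\<phi> i j) - int i\<bar> \<le> 3 * int m \<and> \<bar>int (\<phi> i j) - int j\<bar> \<le> 3 * int m)"

text \<open>These are the leftmost point within reach of \<open>j\<close> and the rightmost one
  within reach of \<open>i\<close>. Where a short plan has mass,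
  \<open>4 * m \<le> j - i \<le> 6 * m\<close>, so the other leg has between \<open>m\<close> and
  \<open>3 * m\<close> steps.\<close>

lemma
  assumes "short_plan R"
  shows relay_left: "relay R (\<lambda>i j. j - 3 * m)" and relay_right: "relay R (\<lambda>i j. i + 3 * m)"
proof -
  have "m < i \<and> i \<le> 3 * m + 1 \<and> 7 * m < j \<and> j \<le> 9 * m + 1 \<and> j \<le> i + 6 * m"
    if "i \<in> {1..n}" "j \<in> {1..n}" "R i j \<noteq> 0" for i j
    using assms that coupling_supp[of R i j] by (auto simp: short_plan_def)
  moreover have "j - 3 * m \<in> {1..n} \<and> \<bar>int (j - 3 * m) - int i\<bar> \<le> 3 * int m \<and>
      \<bar>int (j - 3 * m) - int j\<bar> \<le> 3 * int m"
    and "i + 3 * m \<in> {1..n} \<and> \<bar>int (i + 3 * m) - int i\<bar> \<le> 3 * int m \<and>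
      \<bar>int (i + 3 * m) - int j\<bar> \<le> 3 * int m"
    if "m < i \<and> i \<le> 3 * m + 1 \<and> 7 * m < j \<and> j \<le> 9 * m + 1 \<and> j \<le> i + 6 * m" for i j
    using that m_pos unfolding atLeastAtMost_iff n_eq by linarith+
  ultimately show "relay R (\<lambda>i j. j - 3 * m)" "relay R (\<lambda>i j. i + 3 * m)"
    unfolding relay_def by blast+
qed

text \<open>The monotone coupling is short: for \<open>j > i + 6 * m\<close>, \<open>cum\<close>
  puts the partial sum of \<open>u\<close> up to \<open>i\<close> below that of \<open>v\<close> up
  to \<open>j - 1\<close>, and there the coupling vanishes.\<close>

lemma short_plan_exists:
  obtains R where "short_plan R"
proof -
  obtain R where R: "R \<in> couplings n u v"
    and 0: "\<And>i j. i \<in> {1..n} \<Longrightarrow> j \<in> {1..n} \<Longrightarrow>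
             (\<Sum>k=1..i. u k) \<le> (\<Sum>k=1..j - 1. v k) \<Longrightarrow> R i j = 0"
    using monotone_coupling[OF u_nonneg v_nonneg total] by blast
  have "j \<le> i + 6 * m" if ij: "i \<in> {1..n}" "j \<in> {1..n}" "R i j \<noteq> 0" for i j
  proof (rule ccontr)
    assume "\<not> j \<le> i + 6 * m"
    then have "(\<Sum>k=1..i + 6 * m. v k) \<le> (\<Sum>k=1..j - 1. v k)"
      using ij v_nonneg by (intro sum_mono2) (auto simp: nonneg_vec_def)
    moreover have "(\<Sum>k=1..i. u k) \<le> (\<Sum>k=1..i + 6 * m. v k)"
      using coupling_supp[OF R ij] by (intro cum)
    ultimately show False using 0[OF ij(1,2)] ij(3) by linarith
  qed
  then show ?thesis using R by (intro that) (auto simp: short_plan_def)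
qed

text \<open>Every relay is a competitor in the barycenter problem: its two legs stay within the
  threshold, so their costs are finite and are computed by a change of variables.\<close>

lemma relay_candidate:
  assumes R: "R \<in> couplings n u v" and \<phi>: "relay R \<phi>"
  obtains A Q1 Q2 where "nonneg_vec n A" "Q1 \<in> couplings n A u" "Q2 \<in> couplings n A v"
    "transport_cost n Q1 (trunc_cost n)
       = ereal (\<Sum>i=1..n. \<Sum>j=1..n. R i j * (mesh_pt n (\<phi> i j) - mesh_pt n i)\<^sup>2)"
    "transport_cost n Q2 (trunc_cost n)
       = ereal (\<Sum>i=1..n. \<Sum>j=1..n. R i j * (mesh_pt n (\<phi> i j) - mesh_pt n j)\<^sup>2)"
proof
  let ?A = "\<lambda>x. \<Sum>i=1..n. via n \<phi> R x i"
  let ?Q1 = "via n \<phi> R" and ?Q2 = "via n (\<lambda>j i. \<phi> i j) (\<lambda>j i. R i j)"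
  have \<phi>n: "\<And>i j. i \<in> {1..n} \<Longrightarrow> j \<in> {1..n} \<Longrightarrow> R i j \<noteq> 0 \<Longrightarrow> \<phi> i j \<in> {1..n}"
    using \<phi> by (auto simp: relay_def)
  show Q1: "?Q1 \<in> couplings n ?A u" using R \<phi>n by (rule via_couplings)
  show "?Q2 \<in> couplings n ?A v"
    using via_couplings[OF couplings_transpose[OF R], of "\<lambda>j i. \<phi> i j", OF \<phi>n]
    unfolding via_swap_row[of n \<phi> R] by blast
  show "nonneg_vec n ?A"
    unfolding nonneg_vec_def using couplingsD(1)[OF Q1] by (intro ballI sum_nonneg)
  have "near ?Q1"
    unfolding near_def
  proof (intro ballI impI)
    fix x i assume i: "i \<in> {1..n}" and "?Q1 x i \<noteq> 0"
    then obtain j where "j \<in> {1..n}" "R i j \<noteq> 0" "\<phi> i j = x" by (elim via_support)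
    then show "\<bar>int x - int i\<bar> \<le> 3 * int m" using \<phi> i unfolding relay_def by blast
  qed
  moreover have "near ?Q2"
    unfolding near_def
  proof (intro ballI impI)
    fix x j assume j: "j \<in> {1..n}" and "?Q2 x j \<noteq> 0"
    then obtain i where "i \<in> {1..n}" "R i j \<noteq> 0" "\<phi> i j = x" by (elim via_support)
    then show "\<bar>int x - int j\<bar> \<le> 3 * int m" using \<phi> j unfolding relay_def by blast
  qed
  moreover have "sq_cost n ?Q1 = (\<Sum>i=1..n. \<Sum>j=1..n. R i j * (mesh_pt n (\<phi> i j) - mesh_pt n i)\<^sup>2)"
    unfolding sq_cost_def by (rule via_cost) (rule \<phi>n)
  moreover have "sq_cost n ?Q2 = (\<Sum>i=1..n. \<Sum>j=1..n. R i j * (mesh_pt n (\<phi> i j) - mesh_pt n j)\<^sup>2)"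
    unfolding sq_cost_def by (subst via_cost, rule \<phi>n, assumption+) (rule sum.swap)
  ultimately show "transport_cost n ?Q1 (trunc_cost n)
       = ereal (\<Sum>i=1..n. \<Sum>j=1..n. R i j * (mesh_pt n (\<phi> i j) - mesh_pt n i)\<^sup>2)"
    and "transport_cost n ?Q2 (trunc_cost n)
       = ereal (\<Sum>i=1..n. \<Sum>j=1..n. R i j * (mesh_pt n (\<phi> i j) - mesh_pt n j)\<^sup>2)"
    by (simp_all only: transport_cost_near)
qed

lemma zero_feasible: "(\<lambda>_. 0, \<lambda>_. 0) \<in> sOT_feasible n (trunc_cost n) u v"
proof -
  obtain R where R: "short_plan R" by (rule short_plan_exists)
  then have "R \<in> couplings n u v" by (simp add: short_plan_def)
  then obtain A Q1 Q2 where Q: "nonneg_vec n A" "Q1 \<in> couplings n A u" "Q2 \<in> couplings n A v"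
    and c: "transport_cost n Q1 (trunc_cost n) < \<infinity>" "transport_cost n Q2 (trunc_cost n) < \<infinity>"
  proof (rule relay_candidate[OF _ relay_left[OF R]], goal_cases)
    case (1 A Q1 Q2)
    show ?case by (rule 1(1)[OF 1(2-4)]) (unfold 1(5,6), simp_all)
  qed
  moreover have "norm1 n u = norm1 n v"
    using total u_nonneg v_nonneg by (simp add: norm1_def nonneg_vec_def)
  moreover have "\<exists>a P1 P2. nonneg_vec n a \<and> P1 \<in> couplings n a u \<and> P2 \<in> couplings n a v \<and>
      transport_cost n P1 (trunc_cost n) < \<infinity> \<and> transport_cost n P2 (trunc_cost n) < \<infinity>"
    using Q c by blast
  ultimately show ?thesis
    using u_nonneg v_nonneg unfolding sOT_feasible_def nonneg_vec_def by simp
qed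

lemma norm1_zero: "norm1 n (\<lambda>_. 0) = 0" and norm1_nonneg: "0 \<le> norm1 n w"
  by (auto simp: norm1_def intro: sum_nonneg)

lemma zero_minimal: "(\<lambda>_. 0, \<lambda>_. 0) \<in> sOT_minimal n (trunc_cost n) u v"
  using zero_feasible norm1_nonneg
  by (auto simp: sOT_minimal_def is_arg_min_def norm1_zero not_less intro: add_nonneg_nonneg)

lemma minimal_zero:
  assumes "(\<nu>1, \<nu>2) \<in> sOT_minimal n (trunc_cost n) u v" and i: "i \<in> {1..n}"
  shows "\<nu>1 i = 0" "\<nu>2 i = 0"
proof -
  have "norm1 n \<nu>1 + norm1 n \<nu>2 \<le> 0"
    using assms(1) zero_feasible by (fastforce simp: sOT_minimal_def is_arg_min_def norm1_zero not_less)
  then have "norm1 n \<nu>1 = 0" "norm1 n \<nu>2 = 0"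
    using norm1_nonneg[of \<nu>1] norm1_nonneg[of \<nu>2] by linarith+
  then show "\<nu>1 i = 0" "\<nu>2 i = 0"
    using i by (auto simp: norm1_def sum_nonneg_eq_0_iff)
qed

section \<open>Optimality of a barycenter against relayed plans\<close>

lemma barycenter_optimal:
  assumes bary: "is_sOT_barycenter n (trunc_cost n) l u v a" and l: "l \<in> weights"
  obtains P1 P2 where "P1 \<in> couplings n a u" "P2 \<in> couplings n a v" "near P1" "near P2"
    and "\<And>R \<phi>. R \<in> couplings n u v \<Longrightarrow> relay R \<phi> \<Longrightarrow>
      fst l * sq_cost n P1 + snd l * sq_cost n P2
        \<le> fst l * (\<Sum>i=1..n. \<Sum>j=1..n. R i j * (mesh_pt n (\<phi> i j) - mesh_pt n i)\<^sup>2)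
          + snd l * (\<Sum>i=1..n. \<Sum>j=1..n. R i j * (mesh_pt n (\<phi> i j) - mesh_pt n j)\<^sup>2)"
proof -
  let ?c = "\<lambda>P. transport_cost n P (trunc_cost n)"
  obtain \<nu> P1 P2 where adm: "(\<nu>, a, P1, P2) \<in> sOT_admissible n (trunc_cost n) u v"
    and min: "\<And>y. y \<in> sOT_admissible n (trunc_cost n) u v \<Longrightarrow>
       \<not> (case y of (\<nu>, a, Q1, Q2) \<Rightarrow> ereal (fst l) * ?c Q1 + ereal (snd l) * ?c Q2)
         < ereal (fst l) * ?c P1 + ereal (snd l) * ?c P2"
    using bary unfolding is_sOT_barycenter_def is_arg_min_def by auto
  obtain \<nu>1 \<nu>2 where \<nu>: "\<nu> = (\<nu>1, \<nu>2)" by (cases \<nu>)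
  have min0: "(\<nu>1, \<nu>2) \<in> sOT_minimal n (trunc_cost n) u v"
    and "P1 \<in> couplings n a (\<lambda>i. u i - \<nu>1 i)" "P2 \<in> couplings n a (\<lambda>i. v i - \<nu>2 i)"
    using adm by (auto simp: sOT_admissible_def \<nu>)
  \<comment> \<open>\<open>\<nu>1\<close> and \<open>\<nu>2\<close> are known to vanish only on
    \<open>{1..n}\<close>, which is all that \<open>couplings\<close> sees.\<close>
  moreover have "couplings n a (\<lambda>i. u i - \<nu>1 i) = couplings n a u"
    "couplings n a (\<lambda>i. v i - \<nu>2 i) = couplings n a v"
    using minimal_zero[OF min0] by (auto intro!: couplings_cong)
  ultimately have P: "P1 \<in> couplings n a u" "P2 \<in> couplings n a v" by auto
  have l0: "0 < fst l" "0 < snd l" using l by (auto simp: weights_def)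
  have le: "ereal (fst l) * ?c P1 + ereal (snd l) * ?c P2
      \<le> ereal (fst l * (\<Sum>i=1..n. \<Sum>j=1..n. R i j * (mesh_pt n (\<phi> i j) - mesh_pt n i)\<^sup>2)
          + snd l * (\<Sum>i=1..n. \<Sum>j=1..n. R i j * (mesh_pt n (\<phi> i j) - mesh_pt n j)\<^sup>2))"
    if R: "R \<in> couplings n u v" "relay R \<phi>" for R \<phi>
  proof -
    from relay_candidate[OF R] obtain A Q1 Q2 where Q: "nonneg_vec n A" "Q1 \<in> couplings n A u" "Q2 \<in> couplings n A v"
      "?c Q1 = ereal (\<Sum>i=1..n. \<Sum>j=1..n. R i j * (mesh_pt n (\<phi> i j) - mesh_pt n i)\<^sup>2)"
      "?c Q2 = ereal (\<Sum>i=1..n. \<Sum>j=1..n. R i j * (mesh_pt n (\<phi> i j) - mesh_pt n j)\<^sup>2)"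
      by blast
    then have "((\<lambda>_. 0, \<lambda>_. 0), A, Q1, Q2) \<in> sOT_admissible n (trunc_cost n) u v"
      using zero_minimal by (simp add: sOT_admissible_def)
    from min[OF this] show ?thesis unfolding not_less by (simp add: Q(4,5))
  qed
  \<comment> \<open>Admissibility does not require finite costs. Comparison with one relayed plan
    bounds the weighted sum, and positivity of both weights then makes each cost finite.\<close>
  obtain R where R: "short_plan R" by (rule short_plan_exists)
  then have "R \<in> couplings n u v" by (simp add: short_plan_def)
  from le[OF this relay_left[OF R]] have "ereal (fst l) * ?c P1 + ereal (snd l) * ?c P2 < \<infinity>"
    by (rule order_le_less_trans) simp
  moreover have "0 \<le> ?c P1" "0 \<le> ?c P2"
    using couplingsD(1)[OF P(1)] couplingsD(1)[OF P(2)] by (auto intro!: transport_cost_nonneg)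
  ultimately have "?c P1 < \<infinity>" "?c P2 < \<infinity>"
    using l0 by (cases "?c P1"; cases "?c P2"; auto)+
  then have near: "near P1" "near P2" using P by (auto intro: near_if_finite)
  show ?thesis
    by (rule that[OF P near]) (use le in \<open>simp add: transport_cost_near near\<close>)
qed

section \<open>Distance of a barycenter from the limits\<close>

text \<open>The numerator is the total mass times \<open>0.09 = (3 * m / n)\<^sup>2\<close>, the
  cost of moving everything by \<open>3 * m\<close> steps; it is divided by the saving
  \<open>2 * m / n\<^sup>2\<close> per unit of mass and step.\<close>

definition rate :: real where
  "rate = 0.09 * (\<Sum>i=1..n. u i) * (real n)\<^sup>2 / (2 * real m)"

lemma rate_bound:
  assumes "0 < l" and "l * (2 * real m / (real n)\<^sup>2 * E) \<le> l' * (0.09 * (\<Sum>i=1..n. u i))"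
  shows "E \<le> rate * (l' / l)"
  using assms m_pos unfolding rate_def by (simp add: n_eq field_simps)

text \<open>Moving the relay point from \<open>k\<close> (\<open>p\<close> steps away from its extreme position) to the extreme
  position, which is still \<open>q \<ge> m\<close> steps away from the other mass, saves \<open>p\<^sup>2 + 2 p q \<ge> 2 m p\<close>.\<close>

lemma square_gain:
  fixes p q :: real
  assumes "0 \<le> p" "real m \<le> q"
  shows "(q / real n)\<^sup>2 + 2 * real m / (real n)\<^sup>2 * p \<le> ((p + q) / real n)\<^sup>2"
proof -
  have "real m * p \<le> q * p" using assms by (intro mult_right_mono)
  moreover have "(p + q)\<^sup>2 = p\<^sup>2 + q\<^sup>2 + 2 * (q * p)" by (simp add: power2_sum)
  ultimately have "q\<^sup>2 + 2 * real m * p \<le> (p + q)\<^sup>2"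
    using zero_le_power2[of p] by linarith
  from divide_right_mono[OF this, of "(real n)\<^sup>2"] show ?thesis
    unfolding power_divide by (simp add: add_divide_distrib)
qed

lemma const_cost:
  assumes R: "R \<in> couplings n u v"
    and d: "\<And>i j. i \<in> {1..n} \<Longrightarrow> j \<in> {1..n} \<Longrightarrow> R i j \<noteq> 0 \<Longrightarrow> \<bar>real (f i j) - real (g i j)\<bar> = 3 * real m"
  shows "(\<Sum>i=1..n. \<Sum>j=1..n. R i j * (mesh_pt n (f i j) - mesh_pt n (g i j))\<^sup>2) = 0.09 * (\<Sum>i=1..n. u i)"
proof -
  have "R i j * (mesh_pt n (f i j) - mesh_pt n (g i j))\<^sup>2 = 0.09 * R i j"
    if "i \<in> {1..n}" "j \<in> {1..n}" for i j
  proof (cases "R i j = 0")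
    case False
    have "(real (f i j) - real (g i j))\<^sup>2 = (3 * real m)\<^sup>2"
      using d[OF that False] by (metis power2_abs)
    then have "(mesh_pt n (f i j) - mesh_pt n (g i j))\<^sup>2 = 0.09"
      using m_pos unfolding mesh_diff power_divide by (simp add: n_eq power_mult_distrib)
    then show ?thesis by simp
  qed simp
  then have "(\<Sum>i=1..n. \<Sum>j=1..n. R i j * (mesh_pt n (f i j) - mesh_pt n (g i j))\<^sup>2)
      = (\<Sum>i=1..n. \<Sum>j=1..n. 0.09 * R i j)"
    by (intro sum.cong refl) auto
  then show ?thesis by (simp only: couplings_total[OF R] flip: sum_distrib_left)
qed

context
  fixes a :: "nat \<Rightarrow> real" and P1 P2 :: "nat \<Rightarrow> nat \<Rightarrow> real"
  assumes P1: "P1 \<in> couplings n a u" and P2: "P2 \<in> couplings n a v"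
    and near1: "near P1" and near2: "near P2"
begin

text \<open>The present relay point \<open>k\<close> lies between the extreme ones,
  \<open>j - 3 * m\<close> and \<open>i + 3 * m\<close>. The bounds on \<open>i\<close> and
  \<open>j\<close> keep \<open>j - 3 * m\<close> at least \<open>m\<close> steps from
  \<open>i\<close>, and \<open>i + 3 * m\<close> at least \<open>m\<close> steps from
  \<open>j\<close>.\<close>

lemma triple_supp:
  assumes "k \<in> {1..n}" "i \<in> {1..n}" "j \<in> {1..n}" "P1 k i \<noteq> 0" "P2 k j \<noteq> 0"
  shows "i \<le> 3 * m + 1" "7 * m < j" "k \<le> i + 3 * m" "j \<le> k + 3 * m"
proof -
  have "u i \<noteq> 0" "v j \<noteq> 0"
    using assms couplings_le(2)[OF P1, of k i] couplings_le(2)[OF P2, of k j]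
      couplingsD(1)[OF P1, of k i] couplingsD(1)[OF P2, of k j] by force+
  then show "i \<le> 3 * m + 1" "7 * m < j" using u_supp v_supp assms by auto
  have "\<bar>int k - int i\<bar> \<le> 3 * int m" "\<bar>int k - int j\<bar> \<le> 3 * int m"
    using near1 near2 assms unfolding near_def by blast+
  then show "k \<le> i + 3 * m" "j \<le> k + 3 * m" by linarith+
qed

lemma glue_short: "short_plan (glue n a P1 P2)"
proof -
  have "j \<le> i + 6 * m" if "i \<in> {1..n}" "j \<in> {1..n}" and g: "glue n a P1 P2 i j \<noteq> 0" for i j
  proof -
    obtain k where "k \<in> {1..n}" "P1 k i \<noteq> 0" "P2 k j \<noteq> 0" using g by (rule glue_support)
    then have "k \<le> i + 3 * m" "j \<le> k + 3 * m" using triple_supp that by auto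
    then show ?thesis by simp
  qed
  then show ?thesis using glue_couplings[OF P1 P2] by (auto simp: short_plan_def)
qed

text \<open>The new relay point depends on \<open>j\<close>, which \<open>P1\<close> alone does not
  determine; hence the glued plan. On its triples the saving is \<open>square_gain\<close> with
  \<open>p = k + 3 * m - j\<close> and \<open>q = j - 3 * m - i\<close>. There \<open>p\<close> is
  nonnegative, and the absolute value only matches \<open>coupling_displacement\<close>.\<close>

lemma glue_gain_left:
  "(\<Sum>i=1..n. \<Sum>j=1..n. glue n a P1 P2 i j * (mesh_pt n (j - 3 * m) - mesh_pt n i)\<^sup>2)
     + 2 * real m / (real n)\<^sup>2 * (\<Sum>k=1..n. \<Sum>j=1..n. P2 k j * \<bar>int k + 3 * int m - int j\<bar>)
   \<le> sq_cost n P1"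
proof -
  have "(mesh_pt n (j - 3 * m) - mesh_pt n i)\<^sup>2
      + 2 * real m / (real n)\<^sup>2 * real_of_int \<bar>int k + 3 * int m - int j\<bar> \<le> (mesh_pt n k - mesh_pt n i)\<^sup>2"
    if "k \<in> {1..n}" "i \<in> {1..n}" "j \<in> {1..n}" "P1 k i \<noteq> 0" "P2 k j \<noteq> 0" for k i j
  proof -
    note t = triple_supp[OF that]
    have e: "real_of_int \<bar>int k + 3 * int m - int j\<bar> = real k + 3 * real m - real j"
      "real (j - 3 * m) = real j - 3 * real m"
      using t by linarith+
    show ?thesis
      using square_gain[of "real k + 3 * real m - real j" "real j - 3 * real m - real i"] t
      unfolding mesh_diff e by simp
  qed
  from glue_cost_le[OF P1 P2 this] show ?thesis
    unfolding sq_cost_def sum_distrib_left by (simp add: mult.left_commute)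
qed

text \<open>The mirror image, with \<open>P1\<close> and \<open>P2\<close> exchanged,
  \<open>p = i + 3 * m - k\<close> and \<open>q = j - i - 3 * m\<close>. The form
  \<open>+ - 3 * int m\<close> matches \<open>coupling_displacement\<close> at
  \<open>s = - 3 * int m\<close>.\<close>

lemma glue_gain_right:
  "(\<Sum>i=1..n. \<Sum>j=1..n. glue n a P1 P2 i j * (mesh_pt n (i + 3 * m) - mesh_pt n j)\<^sup>2)
     + 2 * real m / (real n)\<^sup>2 * (\<Sum>k=1..n. \<Sum>i=1..n. P1 k i * \<bar>int k + - 3 * int m - int i\<bar>)
   \<le> sq_cost n P2"
proof -
  have *: "(mesh_pt n (i + 3 * m) - mesh_pt n j)\<^sup>2
      + 2 * real m / (real n)\<^sup>2 * real_of_int \<bar>int k + - 3 * int m - int i\<bar> \<le> (mesh_pt n k - mesh_pt n j)\<^sup>2"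
    if "k \<in> {1..n}" "j \<in> {1..n}" "i \<in> {1..n}" "P2 k j \<noteq> 0" "P1 k i \<noteq> 0" for k i j
  proof -
    note t = triple_supp[OF that(1,3,2,5,4)]
    have e: "real_of_int \<bar>int k + - 3 * int m - int i\<bar> = real i + 3 * real m - real k"
      "real (i + 3 * m) = real i + 3 * real m"
      using t by linarith+
    have f: "(mesh_pt n x - mesh_pt n j)\<^sup>2 = ((real j - real x) / real n)\<^sup>2" for x
      unfolding mesh_diff[symmetric] by (rule power2_commute)
    show ?thesis
      using square_gain[of "real i + 3 * real m - real k" "real j - real i - 3 * real m"] t
      unfolding f e by (simp add: algebra_simps)
  qed
  have "(\<Sum>i=1..n. \<Sum>j=1..n. glue n a P1 P2 i j * (mesh_pt n (i + 3 * m) - mesh_pt n j)\<^sup>2)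
      = (\<Sum>j=1..n. \<Sum>i=1..n. glue n a P2 P1 j i * (mesh_pt n (i + 3 * m) - mesh_pt n j)\<^sup>2)"
    unfolding glue_transpose[of n a P2 P1] by (rule sum.swap)
  with glue_cost_le[OF P2 P1 *] show ?thesis
    unfolding sq_cost_def sum_distrib_left by (simp add: mult.left_commute)
qed

end

text \<open>The competitor is the glued plan of the barycenter itself, relayed through
  \<open>j - 3 * m\<close>. Its first cost is lower by at least a multiple of the displacement
  \<open>?E\<close>, and its second cost is the constant in \<open>rate\<close>. Optimality then
  bounds \<open>?E\<close>, which dominates every entrywise error.\<close>

lemma barycenter_dist_left:
  assumes bary: "is_sOT_barycenter n (trunc_cost n) l u v a" and l: "l \<in> weights" and k: "k \<in> {1..n}"
  shows "\<bar>a k - (if k + 3 * m \<le> n then v (k + 3 * m) else 0)\<bar> \<le> rate * (snd l / fst l)"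
proof -
  obtain P1 P2 where P: "P1 \<in> couplings n a u" "P2 \<in> couplings n a v" "near P1" "near P2"
    and opt: "\<And>R \<phi>. R \<in> couplings n u v \<Longrightarrow> relay R \<phi> \<Longrightarrow>
      fst l * sq_cost n P1 + snd l * sq_cost n P2
        \<le> fst l * (\<Sum>i=1..n. \<Sum>j=1..n. R i j * (mesh_pt n (\<phi> i j) - mesh_pt n i)\<^sup>2)
          + snd l * (\<Sum>i=1..n. \<Sum>j=1..n. R i j * (mesh_pt n (\<phi> i j) - mesh_pt n j)\<^sup>2)"
    using barycenter_optimal[OF bary l] by blast
  let ?G = "glue n a P1 P2"
  let ?E = "\<Sum>k=1..n. \<Sum>j=1..n. P2 k j * \<bar>int k + 3 * int m - int j\<bar>"
  have l0: "0 < fst l" "0 < snd l" using l by (auto simp: weights_def)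
  have G: "?G \<in> couplings n u v" using glue_couplings[OF P(1,2)] .
  have "\<bar>real (j - 3 * m) - real j\<bar> = 3 * real m" if "i \<in> {1..n}" "j \<in> {1..n}" "?G i j \<noteq> 0" for i j
    using coupling_supp[OF G that] by linarith
  then have c: "(\<Sum>i=1..n. \<Sum>j=1..n. ?G i j * (mesh_pt n (j - 3 * m) - mesh_pt n j)\<^sup>2) = 0.09 * (\<Sum>i=1..n. u i)"
    by (rule const_cost[OF G])
  have "fst l * sq_cost n P1 + snd l * sq_cost n P2
      \<le> fst l * (\<Sum>i=1..n. \<Sum>j=1..n. ?G i j * (mesh_pt n (j - 3 * m) - mesh_pt n i)\<^sup>2)
        + snd l * (0.09 * (\<Sum>i=1..n. u i))"
    using opt[OF G relay_left[OF glue_short[OF P]]] unfolding c .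
  moreover have "0 \<le> snd l * sq_cost n P2" using l0 sq_cost_nonneg[OF P(2)] by simp
  moreover have "fst l * (\<Sum>i=1..n. \<Sum>j=1..n. ?G i j * (mesh_pt n (j - 3 * m) - mesh_pt n i)\<^sup>2)
      + fst l * (2 * real m / (real n)\<^sup>2 * ?E) \<le> fst l * sq_cost n P1"
    unfolding distrib_left[symmetric] using glue_gain_left[OF P] l0 by (intro mult_left_mono) auto
  ultimately have E: "?E \<le> rate * (snd l / fst l)"
    using l0 by (intro rate_bound) linarith+
  have "int k + 3 * int m \<in> {1..int n} \<longleftrightarrow> k + 3 * m \<le> n" "nat (int k + 3 * int m) = k + 3 * m"
    using k by auto
  then show ?thesis
    using order_trans[OF coupling_displacement[OF P(2) k, of "3 * int m"] E] by (simp only:)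
qed

text \<open>The same comparison with relay point \<open>i + 3 * m\<close>: now the first cost is
  constant and the second one pays for the displacement.\<close>

lemma barycenter_dist_right:
  assumes bary: "is_sOT_barycenter n (trunc_cost n) l u v a" and l: "l \<in> weights" and k: "k \<in> {1..n}"
  shows "\<bar>a k - (if 3 * m < k then u (k - 3 * m) else 0)\<bar> \<le> rate * (fst l / snd l)"
proof -
  obtain P1 P2 where P: "P1 \<in> couplings n a u" "P2 \<in> couplings n a v" "near P1" "near P2"
    and opt: "\<And>R \<phi>. R \<in> couplings n u v \<Longrightarrow> relay R \<phi> \<Longrightarrow>
      fst l * sq_cost n P1 + snd l * sq_cost n P2
        \<le> fst l * (\<Sum>i=1..n. \<Sum>j=1..n. R i j * (mesh_pt n (\<phi> i j) - mesh_pt n i)\<^sup>2)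
          + snd l * (\<Sum>i=1..n. \<Sum>j=1..n. R i j * (mesh_pt n (\<phi> i j) - mesh_pt n j)\<^sup>2)"
    using barycenter_optimal[OF bary l] by blast
  let ?G = "glue n a P1 P2"
  let ?E = "\<Sum>k=1..n. \<Sum>i=1..n. P1 k i * \<bar>int k + - 3 * int m - int i\<bar>"
  have l0: "0 < fst l" "0 < snd l" using l by (auto simp: weights_def)
  have G: "?G \<in> couplings n u v" using glue_couplings[OF P(1,2)] .
  have c: "(\<Sum>i=1..n. \<Sum>j=1..n. ?G i j * (mesh_pt n (i + 3 * m) - mesh_pt n i)\<^sup>2) = 0.09 * (\<Sum>i=1..n. u i)"
    using const_cost[OF G, of "\<lambda>i j. i + 3 * m" "\<lambda>i j. i"] by simp
  have "fst l * sq_cost n P1 + snd l * sq_cost n P2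
      \<le> fst l * (0.09 * (\<Sum>i=1..n. u i))
        + snd l * (\<Sum>i=1..n. \<Sum>j=1..n. ?G i j * (mesh_pt n (i + 3 * m) - mesh_pt n j)\<^sup>2)"
    using opt[OF G relay_right[OF glue_short[OF P]]] unfolding c .
  moreover have "0 \<le> fst l * sq_cost n P1" using l0 sq_cost_nonneg[OF P(1)] by simp
  moreover have "snd l * (\<Sum>i=1..n. \<Sum>j=1..n. ?G i j * (mesh_pt n (i + 3 * m) - mesh_pt n j)\<^sup>2)
      + snd l * (2 * real m / (real n)\<^sup>2 * ?E) \<le> snd l * sq_cost n P2"
    unfolding distrib_left[symmetric] using glue_gain_right[OF P] l0 by (intro mult_left_mono) auto
  ultimately have E: "?E \<le> rate * (fst l / snd l)"
    using l0 by (intro rate_bound) linarith+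
  have "int k + - 3 * int m \<in> {1..int n} \<longleftrightarrow> 3 * m < k" "nat (int k + - 3 * int m) = k - 3 * m"
    using k by auto
  then show ?thesis
    using order_trans[OF coupling_displacement[OF P(1) k, of "- 3 * int m"] E] by (simp only:)
qed

end

section \<open>From periodic functions to masses on the mesh\<close>

lemma cum_le_cong:
  assumes "\<And>i. i \<in> {1..N} \<Longrightarrow> u i = u' i" "\<And>i. i \<in> {1..N} \<Longrightarrow> v i = v' i"
  shows "cum_le N u v \<longleftrightarrow> cum_le N u' v'"
proof -
  have "(\<Sum>j=1..k. u j) = (\<Sum>j=1..k. u' j)" "(\<Sum>j=1..k. v j) = (\<Sum>j=1..k. v' j)" if "k \<le> N" for k
    using that assms by (auto intro!: sum.cong)
  moreover have "k \<le> N" if "k \<in> {1..N - 1}" for k using that by auto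
  ultimately show ?thesis by (simp only: cum_le_def cong: ball_cong)
qed

text \<open>The endpoint 0.2 is itself the mesh point of index \<open>2 * m + 1\<close>, hence the
  extra point.\<close>

lemma mesh_initial:
  assumes "0 < m" "n = 10 * m"
  shows "mesh n \<inter> {0..0.2} = mesh_pt n ` {1..2 * m + 1}"
proof -
  have "mesh_pt n i \<in> {0..0.2} \<longleftrightarrow> i \<le> 2 * m + 1" if "1 \<le> i" for i
  proof -
    have "mesh_pt n i \<in> {0..0.2} \<longleftrightarrow> real i - 1 \<le> 2 * real m"
      using that assms by (auto simp: mesh_pt_def field_simps)
    also have "\<dots> \<longleftrightarrow> i \<le> 2 * m + 1" by linarith
    finally show ?thesis .
  qed
  then show ?thesis using assms unfolding mesh_def by auto
qed

lemma values_at_mesh_image: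
  assumes n: "0 < n" and i: "i \<in> {1..N}"
  shows "values_at f (mesh_pt n ` {1..N}) i = f (mesh_pt n i)"
proof -
  have sm: "strict_mono (mesh_pt n)"
    using n by (auto simp: strict_mono_def mesh_pt_def divide_strict_right_mono)
  have "sorted_list_of_set (mesh_pt n ` {1..N}) = map (mesh_pt n) [1..<Suc N]"
  proof (rule sorted_distinct_set_unique)
    show "sorted (map (mesh_pt n) [1..<Suc N])"
      unfolding sorted_map by (rule sorted_wrt_mono_rel[OF _ sorted_upt])
        (auto simp: strict_mono_less_eq[OF sm])
    show "distinct (map (mesh_pt n) [1..<Suc N])"
      using strict_mono_imp_inj_on[OF sm] by (simp add: distinct_map inj_on_subset del: upt_Suc)
  qed (auto simp: atLeastLessThanSuc_atLeastAtMost simp del: upt_Suc)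
  then show ?thesis
    using i by (auto simp: values_at_def nth_map[of _ "[Suc 0..<Suc N]"] nth_upt simp del: upt_Suc)
qed

lemma card_mesh_image:
  assumes "0 < n"
  shows "card (mesh_pt n ` {1..N}) = N"
proof -
  have "inj (mesh_pt n)" using assms by (auto simp: inj_def mesh_pt_def)
  then show ?thesis by (simp add: card_image inj_on_subset)
qed

lemma sum_shifted_support:
  fixes w :: "nat \<Rightarrow> real"
  assumes "\<And>i. i \<in> {1..p} \<Longrightarrow> w i = 0"
  shows "(\<Sum>i=1..p + k. w i) = (\<Sum>j=1..k. w (p + j))"
  using assms by (induction k) auto

text \<open>All arguments \<open>y - 0.1\<close> and \<open>y - 0.7\<close> with \<open>y\<close> on
  the mesh lie strictly between -0.8 and 1, so periodicity enters only through the vanishing on that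
  interval off \<open>[0, 0.2]\<close>.\<close>

lemma separated_masses_shift:
  fixes b1 b2 :: "real \<Rightarrow> real"
  assumes m: "0 < m" and n: "n = 10 * m"
    and nn: "\<And>x. 0 \<le> b1 x" "\<And>x. 0 \<le> b2 x"
    and zero: "\<And>x. -0.8 < x \<and> x < 0 \<or> 0.2 < x \<and> x < 1 \<Longrightarrow> b1 x = 0"
      "\<And>x. -0.8 < x \<and> x < 0 \<or> 0.2 < x \<and> x < 1 \<Longrightarrow> b2 x = 0"
    and cum: "cum_le (2 * m + 1) (\<lambda>i. b1 (mesh_pt n i)) (\<lambda>i. b2 (mesh_pt n i))"
  shows "separated_masses m n (values_at (shift 0.1 b1) (mesh n)) (values_at (shift 0.7 b2) (mesh n))"
proof -
  let ?u = "values_at (shift 0.1 b1) (mesh n)" and ?v = "values_at (shift 0.7 b2) (mesh n)"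
  have vals: "?u i = b1 (mesh_pt n i - 0.1)" "?v i = b2 (mesh_pt n i - 0.7)" if "1 \<le> i" "i \<le> n" for i
    using that by (simp_all add: values_at_mesh shift_def)
  have u0: "?u i = 0" if "1 \<le> i" "i \<le> n" "i \<le> m \<or> 3 * m + 1 < i" for i
  proof (subst vals[OF that(1,2)], rule zero)
    have "real i \<le> real m \<or> 3 * real m + 1 < real i" "real i \<le> 10 * real m" "1 \<le> real i"
      using that n by auto
    then show "-0.8 < mesh_pt n i - 0.1 \<and> mesh_pt n i - 0.1 < 0 \<or> 0.2 < mesh_pt n i - 0.1 \<and> mesh_pt n i - 0.1 < 1"
      using m by (auto simp: mesh_pt_def n field_simps)
  qed
  have v0: "?v i = 0" if "1 \<le> i" "i \<le> n" "i \<le> 7 * m \<or> 9 * m + 1 < i" for i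
  proof (subst vals[OF that(1,2)], rule zero)
    have "real i \<le> 7 * real m \<or> 9 * real m + 1 < real i" "real i \<le> 10 * real m" "1 \<le> real i"
      using that n by auto
    then show "-0.8 < mesh_pt n i - 0.7 \<and> mesh_pt n i - 0.7 < 0 \<or> 0.2 < mesh_pt n i - 0.7 \<and> mesh_pt n i - 0.7 < 1"
      using m by (auto simp: mesh_pt_def n field_simps)
  qed
  have sh: "mesh_pt n (m + j) - 0.1 = mesh_pt n j" "mesh_pt n (7 * m + j) - 0.7 = mesh_pt n j" for j
    using m by (simp_all add: mesh_pt_def n field_simps)
  have us: "?u (m + j) = b1 (mesh_pt n j)" and vs: "?v (7 * m + j) = b2 (mesh_pt n j)"
    if "1 \<le> j" "j \<le> 2 * m + 1" for j
    using that m n vals(1)[of "m + j"] vals(2)[of "7 * m + j"] unfolding sh by auto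
  have su: "(\<Sum>i=1..m + k. ?u i) = (\<Sum>j=1..k. b1 (mesh_pt n j))" if "k \<le> 2 * m + 1" for k
    by (subst sum_shifted_support) (use u0 n us that in \<open>auto intro!: sum.cong\<close>)
  have sv: "(\<Sum>i=1..7 * m + k. ?v i) = (\<Sum>j=1..k. b2 (mesh_pt n j))" if "k \<le> 2 * m + 1" for k
    by (subst sum_shifted_support) (use v0 n vs that in \<open>auto intro!: sum.cong\<close>)
  \<comment> \<open>At \<open>k = 2 * m + 1\<close> this is the equality of totals in
    \<open>cum_le\<close>; smaller \<open>k\<close> are its inequalities.\<close>
  have le: "(\<Sum>j=1..k. b1 (mesh_pt n j)) \<le> (\<Sum>j=1..k. b2 (mesh_pt n j))" if "1 \<le> k" "k \<le> 2 * m + 1" for k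
    using cum that by (cases "k = 2 * m + 1") (auto simp: cum_le_def)
  show ?thesis
  proof
    show "nonneg_vec n ?u" "nonneg_vec n ?v" using nn by (auto simp: nonneg_vec_def vals)
    show "m < i \<and> i \<le> 3 * m + 1" if "i \<in> {1..n}" "?u i \<noteq> 0" for i
      using u0[of i] that by force
    show "7 * m < i \<and> i \<le> 9 * m + 1" if "i \<in> {1..n}" "?v i \<noteq> 0" for i
      using v0[of i] that by force
    have "(\<Sum>i=1..n. ?u i) = (\<Sum>i=1..m + (2 * m + 1). ?u i)"
      by (rule sum.mono_neutral_right) (use u0 n m in auto)
    also have "\<dots> = (\<Sum>i=1..7 * m + (2 * m + 1). ?v i)"
      using cum su[of "2 * m + 1"] sv[of "2 * m + 1"] by (simp add: cum_le_def)
    \<comment> \<open>The second block ends at \<open>9 * m + 1\<close>, which is at most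
      \<open>n\<close> because \<open>m\<close> is positive.\<close>
    also have "\<dots> = (\<Sum>i=1..n. ?v i)"
      by (rule sum.mono_neutral_left) (use v0 n m in auto)
    finally show "(\<Sum>i=1..n. ?u i) = (\<Sum>i=1..n. ?v i)" .
    fix i assume i: "m < i" "i \<le> 3 * m + 1"
    then have "i = m + (i - m)" "i + 6 * m = 7 * m + (i - m)" "1 \<le> i - m" "i - m \<le> 2 * m + 1" by auto
    then show "(\<Sum>k=1..i. ?u k) \<le> (\<Sum>k=1..i + 6 * m. ?v k)"
      using le su sv by metis
  qed (use m n in auto)
qed

section \<open>The two limits\<close>

lemma tendsto_weight_rate:
  fixes f :: "real \<times> real \<Rightarrow> real"
  assumes "\<And>l. l \<in> weights \<Longrightarrow> \<bar>f l - w\<bar> \<le> K * (g l / h l)"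
    and "((\<lambda>l. g l / h l) \<longlongrightarrow> 0) (at p within weights)"
  shows "(f \<longlongrightarrow> w) (at p within weights)"
proof (rule LIM_zero_cancel, rule Lim_null_comparison)
  show "\<forall>\<^sub>F l in at p within weights. norm (f l - w) \<le> K * (g l / h l)"
    using assms(1) by (auto simp: eventually_at_filter)
  show "((\<lambda>l. K * (g l / h l)) \<longlongrightarrow> 0) (at p within weights)"
    using tendsto_mult_left[OF assms(2), of K] by simp
qed

theorem theorem4p2:
  fixes n :: nat
    and b1 b2 :: "real \<Rightarrow> real"
    and a :: "real \<times> real \<Rightarrow> nat \<Rightarrow> real"
  assumes "0 < n" and "10 dvd n"
    and "\<And>x. 0 \<le> b1 x" and "\<And>x. 0 \<le> b2 x"
    and "\<And>x. b1 (x + 1) = b1 x" and "\<And>x. b2 (x + 1) = b2 x"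
    and "\<And>x. x \<in> {0..<1} \<Longrightarrow> x \<notin> {0..0.2} \<Longrightarrow> b1 x = 0"
    and "\<And>x. x \<in> {0..<1} \<Longrightarrow> x \<notin> {0..0.2} \<Longrightarrow> b2 x = 0"
    and "cum_le (card (mesh n \<inter> {0..0.2}))
           (values_at b1 (mesh n \<inter> {0..0.2})) (values_at b2 (mesh n \<inter> {0..0.2}))"
    and "\<And>l. l \<in> weights \<Longrightarrow>
           is_sOT_barycenter n (trunc_cost n) l
             (values_at (shift 0.1 b1) (mesh n)) (values_at (shift 0.7 b2) (mesh n)) (a l)"
  shows "(\<forall>i\<in>{1..n}. ((\<lambda>l. a l i) \<longlongrightarrow> values_at (shift 0.4 b2) (mesh n) i) (at (1, 0) within weights)) \<and>
         (\<forall>i\<in>{1..n}. ((\<lambda>l. a l i) \<longlongrightarrow> values_at (shift 0.4 b1) (mesh n) i) (at (0, 1) within weights))"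
proof -
  obtain m where n: "n = 10 * m" using assms(2) by blast
  have m: "0 < m" using assms(1) n by simp
  let ?u = "values_at (shift 0.1 b1) (mesh n)" and ?v = "values_at (shift 0.7 b2) (mesh n)"
  have zero: "b x = 0"
    if b: "\<And>x. b (x + 1) = b x" "\<And>x. x \<in> {0..<1} \<Longrightarrow> x \<notin> {0..0.2} \<Longrightarrow> b x = 0"
      and x: "-0.8 < x \<and> x < 0 \<or> 0.2 < x \<and> x < 1" for b :: "real \<Rightarrow> real" and x
  proof (cases "x < 0")
    case True
    then have "b (x + 1) = 0" using x by (intro b(2)) auto
    then show ?thesis using b(1) by simp
  next
    case False
    then show ?thesis using x by (intro b(2)) auto
  qed
  have z1: "b1 x = 0" and z2: "b2 x = 0" if "-0.8 < x \<and> x < 0 \<or> 0.2 < x \<and> x < 1" for x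
    using zero[of b1 x] zero[of b2 x] assms(5-8) that by blast+
  have vals: "values_at f (mesh n) i = f (mesh_pt n i)" if "i \<in> {1..n}" for f i
    using values_at_mesh[OF that] .
  have "cum_le (2 * m + 1) (\<lambda>i. b1 (mesh_pt n i)) (\<lambda>i. b2 (mesh_pt n i))"
    using assms(9) unfolding mesh_initial[OF m n] card_mesh_image[OF assms(1)]
    by (subst (asm) cum_le_cong[OF values_at_mesh_image values_at_mesh_image]) (use assms(1) in auto)
  from separated_masses_shift[OF m n assms(3,4) z1 z2 this]
  interpret separated_masses m n ?u ?v .
  show ?thesis
  proof (intro conjI ballI)
    fix k assume k: "k \<in> {1..n}"
    \<comment> \<open>A move by \<open>3 * m\<close> steps turns the shift 0.7 into 0.4. If it
      leaves the mesh, the point \<open>y\<close> of index \<open>k\<close> is at least 0.7, and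
      \<open>y - 0.4\<close> lies to the right of the support.\<close>
    have w: "values_at (shift 0.4 b2) (mesh n) k = (if k + 3 * m \<le> n then ?v (k + 3 * m) else 0)"
    proof (cases "k + 3 * m \<le> n")
      case True
      have "mesh_pt n (k + 3 * m) - 0.7 = mesh_pt n k - 0.4" using m by (simp add: mesh_pt_def n field_simps)
      then show ?thesis using k True by (simp add: vals shift_def)
    next
      case False
      have "real k \<ge> 7 * real m + 1" "real k \<le> 10 * real m" using False k n by auto
      then have "0.2 < mesh_pt n k - 0.4" "mesh_pt n k - 0.4 < 1"
        using m by (auto simp: mesh_pt_def n field_simps)
      then have "b2 (mesh_pt n k - 0.4) = 0" by (intro z2) auto
      then show ?thesis using k False by (simp add: vals shift_def)
    qed
    show "((\<lambda>l. a l k) \<longlongrightarrow> values_at (shift 0.4 b2) (mesh n) k) (at (1, 0) within weights)"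
    proof (rule tendsto_weight_rate)
      show "\<bar>a l k - values_at (shift 0.4 b2) (mesh n) k\<bar> \<le> rate * (snd l / fst l)" if "l \<in> weights" for l
        unfolding w by (rule barycenter_dist_left[OF assms(10)[OF that] that k])
      show "((\<lambda>l. snd l / fst l) \<longlongrightarrow> 0) (at (1, 0) within weights)"
        by (auto intro!: tendsto_eq_intros)
    qed
  next
    fix k assume k: "k \<in> {1..n}"
    \<comment> \<open>Likewise 0.1 becomes 0.4. For \<open>k \<le> 3 * m\<close> the argument lies
      between -0.4 and -0.1, where periodicity makes \<open>b1\<close> vanish.\<close>
    have w: "values_at (shift 0.4 b1) (mesh n) k = (if 3 * m < k then ?u (k - 3 * m) else 0)"
    proof (cases "3 * m < k")
      case True
      have "mesh_pt n (k - 3 * m) - 0.1 = mesh_pt n k - 0.4" using m True by (simp add: mesh_pt_def n field_simps of_nat_diff)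
      moreover have "k - 3 * m \<in> {1..n}" using k True by auto
      ultimately show ?thesis using k True by (simp add: vals shift_def)
    next
      case False
      have "real k \<le> 3 * real m" "1 \<le> real k" using False k by auto
      then have "-0.8 < mesh_pt n k - 0.4" "mesh_pt n k - 0.4 < 0"
        using m by (auto simp: mesh_pt_def n field_simps)
      then have "b1 (mesh_pt n k - 0.4) = 0" by (intro z1) auto
      then show ?thesis using k False by (simp add: vals shift_def)
    qed
    show "((\<lambda>l. a l k) \<longlongrightarrow> values_at (shift 0.4 b1) (mesh n) k) (at (0, 1) within weights)"
    proof (rule tendsto_weight_rate)
      show "\<bar>a l k - values_at (shift 0.4 b1) (mesh n) k\<bar> \<le> rate * (fst l / snd l)" if "l \<in> weights" for l
        unfolding w by (rule barycenter_dist_right[OF assms(10)[OF that] that k])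
      show "((\<lambda>l. fst l / snd l) \<longlongrightarrow> 0) (at (0, 1) within weights)"
        by (auto intro!: tendsto_eq_intros)
    qed
  qed
qed

end
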